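(* Let $f\colon\mathbb{C}\to\mathbb{C}$ be a transcendental entire function, and let $R>0$. Then $$\inf_{z\in\mathbb{C}\colon |f(z)|>R}|f'(z)|\cdot\frac{1+|z|^2}{1+|f(z)|^2}=0.$$ *)

theory Defs
  imports "HOL-Complex_Analysis.Complex_Analysis" "HOL-Computational_Algebra.Polynomial"
begin

(* As usual in function theory, an entire function is called transcendental
   if it is not a polynomial; constants count as polynomials. *)
definition transcendental_entire :: "(complex \<Rightarrow> complex) \<Rightarrow> bool" where
  "transcendental_entire f \<longleftrightarrow> f holomorphic_on UNIV \<and> \<not> (\<exists>p :: complex poly. \<forall>z. f z = poly p z)"

end

theory Submission
  imports Defs
begin

text \<open>
  If the infimum were some \<open>\<delta> > 0\<close>, then \<open>f\<close> would satisfy a differential inequality of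
  blow-up type, \<open>\<bar>f'\<bar> \<ge> \<delta> (1 + \<bar>f\<bar>\<^sup>2) / (1 + \<bar>z\<bar>\<^sup>2)\<close>, where \<open>\<bar>f\<bar> > R\<close>: following a curve along which \<open>\<bar>f\<bar>\<close>
  increases as fast as possible, \<open>1/\<bar>f\<bar>\<close> reaches \<open>0\<close> before \<open>1/(1 + \<bar>z\<bar>)\<close> does, so that \<open>f\<close>
  would have a pole in the plane, provided that the curve starts at a point
  with \<open>1 + \<bar>z\<bar> < \<delta> \<bar>f z\<bar>\<close>. Such a point exists because, by Liouville's theorem, a
  transcendental \<open>f\<close> outgrows every linear function of \<open>\<bar>z\<bar>\<close> somewhere.

  No curve has to be constructed: the balance of the two quantities is the potential
  \<open>\<Phi> z = 1/(\<delta> \<bar>f z\<bar>) - 1/(1 + \<bar>z\<bar>)\<close>. It has no minimum on a set \<open>\<bar>f\<bar> \<ge> c\<close> with \<open>c > R\<close>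
  (\<open>spherical_potential_decreases\<close>), yet for suitable \<open>c\<close> it is negative somewhere on that set
  while its lower limit at infinity is nonnegative, so that by compactness it attains a minimum there.
\<close>

text \<open>
  Moving by \<open>t f z / f' z\<close>, against the Newton step, multiplies \<open>f\<close> by \<open>1 + t\<close> to first order. This
  decreases \<open>1/(\<delta> \<bar>f\<bar>)\<close> at the rate \<open>1/(\<delta> \<bar>f z\<bar>)\<close>, whereas \<open>1/(1 + \<bar>z\<bar>)\<close> decreases at most at the
  rate \<open>\<bar>f z / f' z\<bar> / (1 + \<bar>z\<bar>)\<^sup>2\<close>, which the lower bound on the derivative makes smaller.
\<close>
lemma spherical_potential_decreases:
  fixes f :: "complex \<Rightarrow> complex"
  assumes f: "f field_differentiable (at z)" and "\<delta> > 0" and nz: "f z \<noteq> 0"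
    and bound: "\<delta> \<le> norm (deriv f z) * ((1 + (norm z)\<^sup>2) / (1 + (norm (f z))\<^sup>2))"
  shows "\<exists>z'. norm (f z) \<le> norm (f z') \<and>
           1 / (\<delta> * norm (f z')) - 1 / (1 + norm z') < 1 / (\<delta> * norm (f z)) - 1 / (1 + norm z)"
proof -
  define a where "a = norm (f z)"
  define v where "v = f z / deriv f z"
  define u where "u = (\<lambda>t::real. Re (f (z + of_real t * v) / f z))"
  define \<psi> where "\<psi> = (\<lambda>t. 1 / (\<delta> * a * u t) - 1 / (1 + norm z + t * norm v))"
  have "a > 0" using nz by (simp add: a_def)
  have d: "deriv f z \<noteq> 0"
    using bound \<open>\<delta> > 0\<close> by auto
  have "norm v < (1 + norm z)\<^sup>2 / (\<delta> * a)"
  proof -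
    have "1 + a\<^sup>2 > 0" by (simp add: add_pos_nonneg)
    have "\<delta> * a\<^sup>2 < \<delta> * (1 + a\<^sup>2)"
      using \<open>\<delta> > 0\<close> by simp
    also have "\<dots> \<le> norm (deriv f z) * (1 + (norm z)\<^sup>2)"
      using bound \<open>1 + a\<^sup>2 > 0\<close> by (simp add: a_def field_simps)
    also have "\<dots> \<le> norm (deriv f z) * (1 + norm z)\<^sup>2"
      by (intro mult_left_mono) (auto simp: power2_eq_square algebra_simps)
    finally show ?thesis
      using d \<open>a > 0\<close> \<open>\<delta> > 0\<close>
      by (simp add: v_def norm_divide a_def[symmetric] field_simps power2_eq_square)
  qed
  have u0: "u 0 = 1"
    using nz by (simp add: u_def)
  have du: "(u has_real_derivative 1) (at 0)"
  proof -
    have "(f has_field_derivative deriv f z) (at (z + of_real 0 * v))"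
      using f by (simp add: DERIV_deriv_iff_field_differentiable)
    moreover have "((\<lambda>t. z + of_real t * v) has_vector_derivative v) (at 0)"
      by (auto intro!: derivative_eq_intros)
    ultimately have "((\<lambda>t. f (z + of_real t * v)) has_vector_derivative v * deriv f z) (at 0)"
      using field_vector_diff_chain_at[of "\<lambda>t. z + of_real t * v" v 0 f "deriv f z"]
      by (simp add: o_def)
    then have "((\<lambda>t. f (z + of_real t * v) / f z) has_vector_derivative 1) (at 0)"
      using has_vector_derivative_divide[of "\<lambda>t. f (z + of_real t * v)" "v * deriv f z" "at 0" "f z"]
        d nz by (simp add: v_def)
    from has_field_derivative_Re[OF this] show ?thesis
      by (simp add: u_def)
  qed
  have pos: "1 + norm z > 0" by (simp add: add_pos_nonneg)
  have "(\<psi> has_real_derivative - (1 / (\<delta> * a)) + norm v / (1 + norm z)\<^sup>2) (at 0)"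
    unfolding \<psi>_def
    by (rule derivative_eq_intros du refl | use \<open>a > 0\<close> \<open>\<delta> > 0\<close> u0 pos in
        \<open>force simp: field_simps power2_eq_square\<close>)+
  moreover have "- (1 / (\<delta> * a)) + norm v / (1 + norm z)\<^sup>2 < 0"
    using \<open>norm v < _\<close> pos \<open>a > 0\<close> \<open>\<delta> > 0\<close> by (simp add: field_simps)
  ultimately obtain e1 where e1: "e1 > 0" "\<And>t. 0 < t \<Longrightarrow> t < e1 \<Longrightarrow> \<psi> t < \<psi> 0"
    using DERIV_neg_dec_right[of \<psi> _ 0] by (metis add_0)
  obtain e2 where e2: "e2 > 0" "\<And>t. 0 < t \<Longrightarrow> t < e2 \<Longrightarrow> u 0 < u t"
    using DERIV_pos_inc_right[OF du] by auto
  define t where "t = min e1 e2 / 2"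
  have t: "0 < t" "t < e1" "t < e2"
    using e1(1) e2(1) by (auto simp: t_def)
  define z' where "z' = z + of_real t * v"
  have ut: "u t > 1" using e2(2) t u0 by simp
  have fz': "a * u t \<le> norm (f z')"
    using complex_Re_le_cmod[of "f z' / f z"] \<open>a > 0\<close>
    by (simp add: u_def z'_def a_def norm_divide field_simps)
  have nz': "norm z' \<le> norm z + t * norm v"
    using norm_triangle_ineq[of z "of_real t * v"] t by (simp add: z'_def norm_mult)
  have "1 / (\<delta> * norm (f z')) - 1 / (1 + norm z') \<le> \<psi> t"
  proof -
    have "1 / (\<delta> * norm (f z')) \<le> 1 / (\<delta> * a * u t)"
      using fz' ut \<open>a > 0\<close> \<open>\<delta> > 0\<close> by (intro frac_le) (auto simp: mult.assoc)
    moreover have "1 / (1 + norm z + t * norm v) \<le> 1 / (1 + norm z')"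
      using nz' by (intro frac_le) (auto simp: add_pos_nonneg)
    ultimately show ?thesis by (simp add: \<psi>_def)
  qed
  also have "\<dots> < \<psi> 0" using e1(2) t by simp
  also have "\<dots> = 1 / (\<delta> * norm (f z)) - 1 / (1 + norm z)"
    by (simp add: \<psi>_def u0 a_def)
  finally have "1 / (\<delta> * norm (f z')) - 1 / (1 + norm z') < 1 / (\<delta> * norm (f z)) - 1 / (1 + norm z)" .
  moreover have "a \<le> a * u t"
    using \<open>a > 0\<close> ut by simp
  ultimately show ?thesis
    using fz' unfolding a_def by (intro exI[of _ z']) linarith
qed

lemma transcendental_entire_not_linear_bounded:
  assumes "transcendental_entire f"
  shows "\<exists>z. norm (f z) > C * (1 + norm z)"
proof (rule ccontr)
  assume "\<nexists>z. norm (f z) > C * (1 + norm z)"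
  then have le: "norm (f z) \<le> C * (1 + norm z)" for z
    by (simp add: not_less)
  have "C \<ge> 0" using order_trans[OF norm_ge_zero le[of 0]] by simp
  have "norm (f z) \<le> (2 * C) * norm z ^ 1" if "1 \<le> norm z" for z
    using le[of z] mult_left_mono[OF that \<open>C \<ge> 0\<close>] by (simp add: algebra_simps)
  moreover have "f holomorphic_on UNIV"
    using assms by (simp add: transcendental_entire_def)
  ultimately have eq: "f z = (\<Sum>k\<le>1. (deriv ^^ k) f 0 / fact k * z ^ k)" for z
    by (intro Liouville_polynomial[of f 1 "2 * C"]) auto
  have "f z = poly [:f 0, deriv f 0:] z" for z
    using eq[of z] by simp
  then show False
    using assms unfolding transcendental_entire_def by blast
qed

theorem corollary1p6:
  fixes f :: "complex \<Rightarrow> complex" and R :: real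
  assumes "transcendental_entire f"
    and "R > 0"
  shows "(INF z\<in>{z. norm (f z) > R}.
           norm (deriv f z) * ((1 + (norm z)\<^sup>2) / (1 + (norm (f z))\<^sup>2))) = 0"
proof -
  define F where "F = (\<lambda>z. norm (deriv f z) * ((1 + (norm z)\<^sup>2) / (1 + (norm (f z))\<^sup>2)))"
  define \<delta> where "\<delta> = (INF z\<in>{z. norm (f z) > R}. F z)"
  have hol: "f holomorphic_on UNIV"
    using assms by (simp add: transcendental_entire_def)
  have cont: "continuous_on A f" for A
    using hol holomorphic_on_imp_continuous_on continuous_on_subset by blast
  have large: "\<exists>z. norm (f z) > R \<and> norm (f z) > K * (1 + norm z)" for K
  proof -
    obtain z where z: "norm (f z) > max R K * (1 + norm z)"
      using transcendental_entire_not_linear_bounded[OF assms(1)] by blast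
    have "R * 1 \<le> max R K * (1 + norm z)"
      using \<open>R > 0\<close> by (intro mult_mono) auto
    moreover have "K * (1 + norm z) \<le> max R K * (1 + norm z)"
      by (intro mult_right_mono) auto
    ultimately show ?thesis using z by (intro exI[of _ z]) linarith
  qed
  have F0: "F z \<ge> 0" for z
    by (simp add: F_def)
  have "\<delta> \<ge> 0"
    unfolding \<delta>_def using large F0 by (intro cINF_greatest) auto
  moreover have False if "\<delta> > 0"
  proof -
    have bound: "\<delta> \<le> F z" if "norm (f z) > R" for z
      unfolding \<delta>_def using that F0 by (intro cINF_lower bdd_belowI2[of _ 0]) auto
    define \<Phi> where "\<Phi> = (\<lambda>z. 1 / (\<delta> * norm (f z)) - 1 / (1 + norm z))"
    obtain z0 where z0: "norm (f z0) > R" "norm (f z0) > (1 / \<delta>) * (1 + norm z0)"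
      using large by blast
    have neg: "\<Phi> z0 < 0"
    proof -
      have "1 + norm z0 < \<delta> * norm (f z0)"
        using z0(2) \<open>\<delta> > 0\<close> by (simp add: field_simps)
      then have "1 / (\<delta> * norm (f z0)) < 1 / (1 + norm z0)"
        using norm_ge_zero[of z0] by (intro frac_less2) linarith+
      then show ?thesis by (simp add: \<Phi>_def)
    qed
    \<comment> \<open>For \<open>\<bar>z\<bar> \<ge> \<rho>\<close> already the term \<open>- 1/(1 + \<bar>z\<bar>)\<close> alone is at least \<open>\<Phi> z0\<close>.\<close>
    define \<rho> where "\<rho> = max (norm z0) (1 / (- \<Phi> z0))"
    define S where "S = cball 0 \<rho> \<inter> {z. norm (f z0) \<le> norm (f z)}"
    have "compact S"
      unfolding S_def
      by (intro compact_Int_closed compact_cball closed_Collect_le continuous_intros cont)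
    moreover have "z0 \<in> S"
      by (simp add: S_def \<rho>_def)
    moreover have "continuous_on S \<Phi>"
    proof -
      have "f z \<noteq> 0" if "z \<in> S" for z
        using that z0(1) \<open>R > 0\<close> by (auto simp: S_def)
      moreover have "1 + norm z \<noteq> 0" for z :: complex
        using norm_ge_zero[of z] by linarith
      ultimately show ?thesis
        unfolding \<Phi>_def using \<open>\<delta> > 0\<close> by (intro continuous_intros cont) auto
    qed
    ultimately obtain z1 where z1: "z1 \<in> S" "\<And>z. z \<in> S \<Longrightarrow> \<Phi> z1 \<le> \<Phi> z"
      using continuous_attains_inf[of S \<Phi>] by blast
    have f1: "norm (f z1) \<ge> norm (f z0)" using z1(1) by (simp add: S_def)
    have "\<exists>z'. norm (f z1) \<le> norm (f z') \<and> \<Phi> z' < \<Phi> z1"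
      unfolding \<Phi>_def
    proof (rule spherical_potential_decreases)
      show "f field_differentiable at z1"
        using hol by (simp add: holomorphic_on_imp_differentiable_at)
      show "f z1 \<noteq> 0" using f1 z0(1) \<open>R > 0\<close> by auto
      show "\<delta> \<le> norm (deriv f z1) * ((1 + (norm z1)\<^sup>2) / (1 + (norm (f z1))\<^sup>2))"
        using bound[of z1] f1 z0(1) by (simp add: F_def)
    qed (rule \<open>\<delta> > 0\<close>)
    then obtain z' where z': "norm (f z1) \<le> norm (f z')" "\<Phi> z' < \<Phi> z1" by blast
    have "norm z' \<le> \<rho>"
    proof (rule ccontr)
      assume "\<not> norm z' \<le> \<rho>"
      then have "1 / (- \<Phi> z0) < 1 + norm z'" by (simp add: \<rho>_def)
      then have "1 < (1 + norm z') * - \<Phi> z0"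
        using neg by (simp only: pos_divide_less_eq neg_0_less_iff_less)
      then have "\<Phi> z0 < - 1 / (1 + norm z')"
        by (simp add: add_pos_nonneg field_simps)
      also have "\<dots> \<le> \<Phi> z'"
        using \<open>\<delta> > 0\<close> by (simp add: \<Phi>_def)
      finally show False
        using z'(2) z1(2)[OF \<open>z0 \<in> S\<close>] by linarith
    qed
    then have "z' \<in> S" using z'(1) f1 by (simp add: S_def)
    then show False using z1(2) z'(2) by fastforce
  qed
  ultimately have "\<delta> = 0" by fastforce
  then show ?thesis by (simp only: \<delta>_def F_def)
qed

end
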